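(* Let $q\ge 2$ be an integer and let $\mu$ be an invariant locally square-integrable point process on the $(q+1)$-regular tree $\mathbb{T}_{q+1}$, with diffraction measure $\sigma_\mu$. Then $$\limsup_{r \to +\infty} \frac{\mathrm{NV}_\mu^*(r)}{|B_r(o)|} > 0 .$$ Moreover: (1) if $\sigma_\mu(\{0,\tfrac{\pi}{\log q}\})>0$, then $$\liminf_{r \to +\infty} \frac{\mathrm{NV}_\mu^*(r)}{r^2|B_r(o)|} > 0 ;$$ (2) if there is a $\delta\in(0,1)$ such that $\sigma_\mu\big(i[\tfrac{\delta}{2},\tfrac12)\big)>0$ or $\sigma_\mu\big(\tfrac{\pi}{\log q}+i[\tfrac{\delta}{2},\tfrac12)\big)>0$, then $$\liminf_{r \to +\infty} \frac{\mathrm{NV}_\mu^*(r)}{|B_r(o)|^{1+\delta}} > 0 .$$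
   Context: Fix an integer $q\ge2$. $\mathbb{T}_{q+1}$ denotes (the vertex set of) the $(q+1)$-regular tree with graph metric $d$ and root $o$; $B_r(o)=\{x: d(x,o)\le r\}$ for integers $r\ge0$. A point process on $\mathbb{T}_{q+1}$ is a Borel probability measure $\mu$ on the space $\mathscr{M}_+(\mathbb{T}_{q+1})$ of positive locally finite measures $p$ on $\mathbb{T}_{q+1}$ (identified with functions $p:\mathbb{T}_{q+1}\to\mathbb{R}_{\ge0}$, topology of pointwise convergence). It is invariant if it is invariant under the push-forward action of $\operatorname{Aut}(\mathbb{T}_{q+1})$, and locally square-integrable if $\int p(\{x\})^2\,d\mu(p)<\infty$ for all vertices $x$. For finitely supported $f:\mathbb{T}_{q+1}\to\mathbb{C}$ put $\mathbb{S}f(p)=\sum_x p(\{x\})f(x)$. For $\lambda\in\mathbb{C}$, $\omega_\lambda$ is the unique function on $\mathbb{T}_{q+1}$ that depends only on $d(x,o)$, has $\omega_\lambda(o)=1$, and satisfies $\sum_{y\sim x}\omega_\lambda(y)=2\sqrt q\cos(\lambda\log q)\,\omega_\lambda(x)$ for all $x$ (the spherical function). For finitely supported radial $f$ (i.e. depending only on $d(x,o)$) set $\hat f(\lambda)=\sum_x f(x)\omega_\lambda(x)$. Let $\Lambda_q=i[0,\tfrac12]\cup(0,\tfrac{\pi}{\log q})\cup(\tfrac{\pi}{\log q}+i[0,\tfrac12])\subset\mathbb{C}$ and $\Lambda_q^*=\Lambda_q\setminus\{\tfrac i2,\tfrac{\pi}{\log q}+\tfrac i2\}$. The diffraction measure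 of an invariant locally square-integrable point process $\mu$ is the unique positive finite Borel measure $\sigma_\mu$ on $\Lambda_q$ such that $\int \mathbb{S}f_1\,\overline{\mathbb{S}f_2}\,d\mu=\int_{\Lambda_q}\hat f_1(\lambda)\overline{\hat f_2(\lambda)}\,d\sigma_\mu(\lambda)$ for all finitely supported radial $f_1,f_2$ (its existence and uniqueness are taken as known). The sub-oscillatory number variance is, for integers $r\ge0$, $$\mathrm{NV}^*_\mu(r)=\int_{\Lambda_q^*}|\hat\chi_{B_r(o)}(\lambda)|^2d\sigma_\mu(\lambda)=q^r\int_{\Lambda_q^*}\frac{\big(\sin(\lambda(r+1)\log q)+q^{-1/2}\sin(\lambda r\log q)\big)^2}{\sin^2(\lambda\log q)}\,d\sigma_\mu(\lambda),$$ where $\chi_{B_r(o)}$ is the indicator function of $B_r(o)$ and the integrand is extended by continuity to $\lambda\in\{0,\tfrac{\pi}{\log q}\}$.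
   Formalization: The first (limsup) claim is proved under the added assumption σ_μ(Λ_q^* ) > 0; without it the claim fails, e.g. for the deterministic process p = 1, where σ_μ is the point mass at i/2 and NV^* vanishes identically. *)

theory Defs
  imports "HOL-Probability.Probability"
begin

section \<open>Regular trees\<close>

text \<open>Graphs are given by their adjacency relation; the vertex set is the whole type.\<close>

definition simple_graph :: "('v \<Rightarrow> 'v \<Rightarrow> bool) \<Rightarrow> bool" where
  "simple_graph E \<longleftrightarrow> (\<forall>x. \<not> E x x) \<and> (\<forall>x y. E x y \<longrightarrow> E y x)"

definition connected_graph :: "('v \<Rightarrow> 'v \<Rightarrow> bool) \<Rightarrow> bool" where
  "connected_graph E \<longleftrightarrow> (\<forall>x y. E\<^sup>*\<^sup>* x y)"

definition graph_cycle :: "('v \<Rightarrow> 'v \<Rightarrow> bool) \<Rightarrow> 'v list \<Rightarrow> bool" where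
  "graph_cycle E c \<longleftrightarrow>
     length c \<ge> 3 \<and> distinct c \<and> successively E c \<and> E (last c) (hd c)"

definition tree_graph :: "('v \<Rightarrow> 'v \<Rightarrow> bool) \<Rightarrow> bool" where
  "tree_graph E \<longleftrightarrow> simple_graph E \<and> connected_graph E \<and> (\<nexists>c. graph_cycle E c)"

text \<open>Since \<open>q + 1 > 0\<close>, the condition on \<open>card\<close> also says that neighbourhoods are finite.\<close>

definition regular_tree :: "nat \<Rightarrow> ('v \<Rightarrow> 'v \<Rightarrow> bool) \<Rightarrow> bool" where
  "regular_tree q E \<longleftrightarrow> tree_graph E \<and> (\<forall>x. card {y. E x y} = q + 1)"

definition graph_dist :: "('v \<Rightarrow> 'v \<Rightarrow> bool) \<Rightarrow> 'v \<Rightarrow> 'v \<Rightarrow> nat" where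
  "graph_dist E x y = (LEAST n. (E ^^ n) x y)"

definition graph_ball :: "('v \<Rightarrow> 'v \<Rightarrow> bool) \<Rightarrow> 'v \<Rightarrow> nat \<Rightarrow> 'v set" where
  "graph_ball E v r = {x. graph_dist E x v \<le> r}"

definition graph_aut :: "('v \<Rightarrow> 'v \<Rightarrow> bool) \<Rightarrow> ('v \<Rightarrow> 'v) set" where
  "graph_aut E = {g. bij g \<and> (\<forall>x y. E (g x) (g y) \<longleftrightarrow> E x y)}"


section \<open>Point processes\<close>

text \<open>A positive locally finite measure on a countable discrete set is identified with the
  function of its point masses.  The Borel structure is the one of the topology of pointwise
  convergence, which is the topology that the function type carries.\<close>

definition pos_measures :: "('v \<Rightarrow> real) set" where
  "pos_measures = {p. \<forall>x. 0 \<le> p x}"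

definition point_process :: "('v \<Rightarrow> real) measure \<Rightarrow> bool" where
  "point_process \<mu> \<longleftrightarrow> prob_space \<mu> \<and> sets \<mu> = sets (restrict_space borel pos_measures)"

text \<open>The push-forward of \<open>p\<close> under \<open>g\<close> has the mass \<open>p (inv g x)\<close> at \<open>x\<close>.\<close>

definition invariant_process ::
    "('v \<Rightarrow> 'v \<Rightarrow> bool) \<Rightarrow> ('v \<Rightarrow> real) measure \<Rightarrow> bool" where
  "invariant_process E \<mu> \<longleftrightarrow> (\<forall>g\<in>graph_aut E. distr \<mu> \<mu> (\<lambda>p. p \<circ> inv g) = \<mu>)"

definition locally_square_integrable :: "('v \<Rightarrow> real) measure \<Rightarrow> bool" where
  "locally_square_integrable \<mu> \<longleftrightarrow> (\<forall>x. integrable \<mu> (\<lambda>p. (p x)\<^sup>2))"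

definition fin_supp :: "('v \<Rightarrow> complex) \<Rightarrow> bool" where
  "fin_supp f \<longleftrightarrow> finite {x. f x \<noteq> 0}"

definition lin_stat :: "('v \<Rightarrow> complex) \<Rightarrow> ('v \<Rightarrow> real) \<Rightarrow> complex" where
  "lin_stat f p = (\<Sum>x | f x \<noteq> 0. complex_of_real (p x) * f x)"


section \<open>Spherical transform\<close>

definition radial :: "('v \<Rightarrow> 'v \<Rightarrow> bool) \<Rightarrow> 'v \<Rightarrow> ('v \<Rightarrow> complex) \<Rightarrow> bool" where
  "radial E v f \<longleftrightarrow> (\<forall>x y. graph_dist E x v = graph_dist E y v \<longrightarrow> f x = f y)"

definition spherical_fun ::
    "nat \<Rightarrow> ('v \<Rightarrow> 'v \<Rightarrow> bool) \<Rightarrow> 'v \<Rightarrow> complex \<Rightarrow> 'v \<Rightarrow> complex" where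
  "spherical_fun q E v z = (THE w. radial E v w \<and> w v = 1 \<and>
     (\<forall>x. (\<Sum>y | E x y. w y)
        = 2 * complex_of_real (sqrt (real q)) * cos (z * complex_of_real (ln (real q))) * w x))"

definition spherical_transform ::
    "nat \<Rightarrow> ('v \<Rightarrow> 'v \<Rightarrow> bool) \<Rightarrow> 'v \<Rightarrow> ('v \<Rightarrow> complex) \<Rightarrow> complex \<Rightarrow> complex" where
  "spherical_transform q E v f z = (\<Sum>x | f x \<noteq> 0. f x * spherical_fun q E v z x)"


section \<open>Diffraction measure and sub-oscillatory number variance\<close>

definition spec_params :: "nat \<Rightarrow> complex set" where
  "spec_params q = Complex 0 ` {0..1/2}
     \<union> complex_of_real ` {0<..<pi / ln (real q)}
     \<union> Complex (pi / ln (real q)) ` {0..1/2}"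

definition spec_params_star :: "nat \<Rightarrow> complex set" where
  "spec_params_star q = spec_params q - {Complex 0 (1/2), Complex (pi / ln (real q)) (1/2)}"

definition diffraction_measure ::
    "nat \<Rightarrow> ('v \<Rightarrow> 'v \<Rightarrow> bool) \<Rightarrow> 'v \<Rightarrow> ('v \<Rightarrow> real) measure \<Rightarrow> complex measure \<Rightarrow> bool" where
  "diffraction_measure q E v \<mu> \<sigma> \<longleftrightarrow>
     finite_measure \<sigma> \<and> sets \<sigma> = sets (restrict_space borel (spec_params q)) \<and>
     (\<forall>f1 f2. fin_supp f1 \<and> radial E v f1 \<and> fin_supp f2 \<and> radial E v f2 \<longrightarrow>
        (LINT p|\<mu>. lin_stat f1 p * cnj (lin_stat f2 p))
      = (LINT z|\<sigma>. spherical_transform q E v f1 z * cnj (spherical_transform q E v f2 z)))"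

text \<open>This vanishes identically when \<open>\<sigma>\<close> does not charge \<open>spec_params_star q\<close>, for instance for the
  deterministic process \<open>p = 1\<close>, whose diffraction measure is the point mass at \<open>Complex 0 (1/2)\<close>.\<close>

definition NV_star ::
    "nat \<Rightarrow> ('v \<Rightarrow> 'v \<Rightarrow> bool) \<Rightarrow> 'v \<Rightarrow> complex measure \<Rightarrow> nat \<Rightarrow> real" where
  "NV_star q E v \<sigma> r =
     (LINT z:spec_params_star q|\<sigma>. (cmod (spherical_transform q E v (indicator (graph_ball E v r)) z))\<^sup>2)"

end

theory Submission
  imports Defs
begin

text \<open>
  The spherical transform of the ball of radius \<open>n\<close> is \<open>q\<^sup>n\<^sup>/\<^sup>2 u\<^sub>n\<close>, where \<open>u\<^sub>0 = 1\<close>, \<open>u\<^sub>1 = y + h\<close> and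
  \<open>u\<^sub>n\<^sub>+\<^sub>2 = y u\<^sub>n\<^sub>+\<^sub>1 - u\<^sub>n\<close> with \<open>h = q\<^sup>-\<^sup>1\<^sup>/\<^sup>2\<close> and \<open>y = 2 cos (z ln q)\<close>, which is real on the spectrum; balls
  have size at most \<open>4 q\<^sup>n\<close>.  The quadratic form \<open>u\<^sub>n\<^sup>2 - y u\<^sub>n u\<^sub>n\<^sub>+\<^sub>1 + u\<^sub>n\<^sub>+\<^sub>1\<^sup>2\<close> does not depend on \<open>n\<close>: it is
  \<open>1 + y h + h\<^sup>2\<close>, which is positive on the punctured spectrum.  So two consecutive values cannot both
  be small, and integrating gives the limsup bound.  At \<open>y = 2\<close> and \<open>y = -2\<close> the sequence grows
  linearly, and for \<open>\<bar>y\<bar> = 2 cosh \<theta>\<close> at least like \<open>exp (n \<theta>)\<close>, whence the two liminf bounds.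
\<close>

fun ball_poly :: "nat \<Rightarrow> complex \<Rightarrow> nat \<Rightarrow> complex" where
  "ball_poly q c 0 = 1"
| "ball_poly q c (Suc 0) = c + 1"
| "ball_poly q c (Suc (Suc n)) = c * ball_poly q c (Suc n) - of_nat q * ball_poly q c n"

section \<open>Spheres in a regular tree\<close>

context
  fixes q :: nat and E :: "'v \<Rightarrow> 'v \<Rightarrow> bool" and v :: 'v
  assumes tree: "regular_tree q E"
begin

abbreviation (input) height :: "'v \<Rightarrow> nat" where
  "height x \<equiv> graph_dist E x v"

section \<open>Levels of the tree: each vertex other than the root has exactly one lower
  neighbour\<close>

lemma adj_sym: "E x y \<Longrightarrow> E y x"
  and adj_irrefl: "\<not> E x x"
  and no_cycle: "\<not> graph_cycle E c"
  and card_neighbours: "card {y. E x y} = q + 1"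
  using tree by (auto simp: regular_tree_def tree_graph_def simple_graph_def)

lemma finite_neighbours: "finite {y. E x y}"
  using card_neighbours[of x] card.infinite by fastforce

lemma relpowp_height: "(E ^^ height x) x v"
proof -
  have "E\<^sup>*\<^sup>* x v"
    using tree by (auto simp: regular_tree_def tree_graph_def connected_graph_def)
  then obtain n where "(E ^^ n) x v"
    by (auto simp: rtranclp_power)
  then show ?thesis
    unfolding graph_dist_def by (rule LeastI)
qed

lemma height_le: "(E ^^ n) x v \<Longrightarrow> height x \<le> n"
  unfolding graph_dist_def by (rule Least_le)

lemma height_eq_0_iff: "height x = 0 \<longleftrightarrow> x = v"
  using relpowp_height[of x] height_le[of 0 x] by auto

lemma height_adj_le: "E x y \<Longrightarrow> height x \<le> Suc (height y)"
  by (rule height_le) (rule relpowp_Suc_I2[OF _ relpowp_height])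

lemma parent_exists:
  assumes "height x = Suc n"
  shows "\<exists>y. E x y \<and> height y = n"
proof -
  from relpowp_height[of x] assms obtain y where y: "E x y" "(E ^^ n) y v"
    by (metis relpowp_Suc_D2)
  with height_le[OF y(2)] height_adj_le[OF y(1)] assms show ?thesis
    by auto
qed

text \<open>Requiring length at least 3 also excludes the edge \<open>[a, b]\<close>, so that the same path closes up
  to a cycle both through a common upper neighbour and through an edge between \<open>a\<close> and \<open>b\<close>.\<close>

lemma path_below:
  assumes "height a = n" "height b = n" "a \<noteq> b"
  shows "\<exists>p. distinct p \<and> successively E p \<and> p \<noteq> [] \<and> hd p = a \<and> last p = b \<and> length p \<ge> 3
           \<and> (\<forall>x\<in>set p. height x \<le> n)"
  using assms
proof (induction n arbitrary: a b)
  case 0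
  then show ?case by (simp add: height_eq_0_iff)
next
  case (Suc n)
  obtain a' b' where par: "E a a'" "height a' = n" "E b b'" "height b' = n"
    using parent_exists[OF Suc.prems(1)] parent_exists[OF Suc.prems(2)] by blast
  show ?case
  proof (cases "a' = b'")
    case True
    have "a \<noteq> a'" "b \<noteq> a'"
      using Suc.prems(1,2) par(2) n_not_Suc_n by metis+
    then have "distinct [a, a', b]" "successively E [a, a', b]"
      using Suc.prems(3) par(1) adj_sym[OF par(3)] True by auto
    moreover have "\<forall>x\<in>set [a, a', b]. height x \<le> Suc n"
      using Suc.prems(1,2) par(2) by simp
    ultimately show ?thesis
      by (intro exI[of _ "[a, a', b]"]) auto
  next
    case False
    from Suc.IH[OF par(2) par(4) False] obtain p where p: "distinct p" "successively E p"
      "p \<noteq> []" "hd p = a'" "last p = b'" "\<forall>x\<in>set p. height x \<le> n"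
      by blast
    \<comment> \<open>The height bound carried through the induction keeps both new end points off
      the inner path.\<close>
    have "a \<notin> set p" "b \<notin> set p"
      using p(6) Suc.prems(1,2) not_less_eq_eq le_refl by metis+
    then have "distinct (a # p @ [b])" "successively E (a # p @ [b])"
      using p(1-5) par(1) Suc.prems(3) adj_sym[OF par(3)]
      by (auto simp: successively_Cons successively_append_iff)
    moreover have "\<forall>x\<in>set (a # p @ [b]). height x \<le> Suc n"
      using p(6) Suc.prems(1,2) by (simp add: le_SucI)
    moreover have "length (a # p @ [b]) \<ge> 3"
      using p(3) by (cases p) auto
    ultimately show ?thesis
      by (intro exI[of _ "a # p @ [b]"]) auto
  qed
qed

lemma height_adj_neq:
  assumes "E x y"
  shows "height x \<noteq> height y"
proof
  assume eq: "height x = height y"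
  have "x \<noteq> y" using assms adj_irrefl by auto
  from path_below[OF refl eq[symmetric] this] obtain p where
    "distinct p" "successively E p" "hd p = x" "last p = y" "length p \<ge> 3"
    by blast
  then have "graph_cycle E p"
    using adj_sym[OF assms] by (auto simp: graph_cycle_def)
  with no_cycle show False by blast
qed

text \<open>A path from \<open>a\<close> to \<open>b\<close> of height at most \<open>n\<close>
  misses the higher vertex \<open>x\<close>, so adding \<open>x\<close> would close a cycle. The
  lemma later makes the child sets of different vertices disjoint.\<close>

lemma parent_unique:
  assumes "E x a" "E x b" "height x = Suc n" "height a = n" "height b = n"
  shows "a = b"
proof (rule ccontr)
  assume "a \<noteq> b"
  from path_below[OF assms(4,5) this] obtain p where p:
    "distinct p" "successively E p" "p \<noteq> []" "hd p = a" "last p = b" "length p \<ge> 3"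
    "\<forall>x\<in>set p. height x \<le> n"
    by blast
  have "x \<notin> set p" using p(7) assms(3) not_less_eq_eq le_refl by metis
  then have "graph_cycle E (x # p)"
    using p assms(1) adj_sym[OF assms(2)] by (simp add: graph_cycle_def successively_Cons)
  with no_cycle show False by blast
qed

lemma height_adj_cases: "E x y \<Longrightarrow> height x = Suc (height y) \<or> height y = Suc (height x)"
  using height_adj_le[of x y] height_adj_le[of y x] height_adj_neq[of x y] adj_sym[of x y]
  by linarith

section \<open>Children, and the sizes of spheres and balls\<close>

definition children :: "'v \<Rightarrow> 'v set" where
  "children x = {y. E x y \<and> height y = Suc (height x)}"

lemma finite_children: "finite (children x)"
  unfolding children_def by (rule finite_subset[OF _ finite_neighbours[of x]]) auto

lemma neighbours_root: "{y. E v y} = children v"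
  using height_adj_cases[of v] height_eq_0_iff[of v] by (auto simp: children_def)

lemma neighbours_nonroot:
  assumes "height x = Suc n"
  obtains y where "E x y" "height y = n" "{y. E x y} = insert y (children x)" "y \<notin> children x"
proof -
  obtain y where y: "E x y" "height y = n" using parent_exists[OF assms] by blast
  have "{y. E x y} = insert y (children x)"
  proof (intro set_eqI iffI)
    fix z assume "z \<in> {z. E x z}"
    then show "z \<in> insert y (children x)"
      using height_adj_cases[of x z] assms parent_unique[OF _ y(1) assms _ y(2), of z]
      unfolding children_def by fastforce
  qed (use y(1) in \<open>auto simp: children_def\<close>)
  moreover have "y \<notin> children x" using y(2) assms unfolding children_def by simp
  ultimately show ?thesis using y that by blast
qed

lemma card_children: "card (children x) = (if x = v then q + 1 else q)"
proof (cases "x = v")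
  case True
  then show ?thesis using card_neighbours[of v] neighbours_root by simp
next
  case False
  then obtain n where "height x = Suc n"
    using height_eq_0_iff[of x] not0_implies_Suc by blast
  then obtain y where "{y. E x y} = insert y (children x)" "y \<notin> children x"
    using neighbours_nonroot by metis
  then show ?thesis
    using card_neighbours[of x] False by (simp add: finite_children)
qed

definition sphere_at :: "nat \<Rightarrow> 'v set" where
  "sphere_at n = {x. height x = n}"

fun sphere_size :: "nat \<Rightarrow> nat" where
  "sphere_size 0 = 1"
| "sphere_size (Suc n) = (if n = 0 then q + 1 else q) * sphere_size n"

lemma sphere_at_Suc: "sphere_at (Suc n) = (\<Union>x\<in>sphere_at n. children x)"
proof (intro set_eqI iffI)
  fix y assume y: "y \<in> sphere_at (Suc n)"
  then obtain x where "E y x" "height x = n"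
    using parent_exists[of y n] unfolding sphere_at_def by blast
  with y adj_sym[of y x] have "x \<in> sphere_at n" "y \<in> children x"
    by (simp_all add: sphere_at_def children_def)
  then show "y \<in> (\<Union>x\<in>sphere_at n. children x)" by blast
qed (auto simp: sphere_at_def children_def)

text \<open>By \<open>parent_unique\<close> the next sphere is a disjoint union of child sets.
  Finiteness joins the induction because \<open>card_UN_disjoint\<close> needs a finite index
  set.\<close>

lemma finite_card_sphere: "finite (sphere_at n) \<and> card (sphere_at n) = sphere_size n"
proof (induction n)
  case 0
  have "sphere_at 0 = {v}" by (auto simp: sphere_at_def height_eq_0_iff)
  then show ?case by simp
next
  case (Suc n)
  have "card (sphere_at (Suc n)) = (\<Sum>x\<in>sphere_at n. card (children x))"
    unfolding sphere_at_Suc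
  proof (rule card_UN_disjoint)
    show "\<forall>x\<in>sphere_at n. \<forall>y\<in>sphere_at n. x \<noteq> y \<longrightarrow> children x \<inter> children y = {}"
    proof (intro ballI impI, rule ccontr)
      fix x y assume xy: "x \<in> sphere_at n" "y \<in> sphere_at n" "x \<noteq> y"
        and "children x \<inter> children y \<noteq> {}"
      then obtain z where "z \<in> children x" "z \<in> children y" by blast
      with xy parent_unique[OF adj_sym adj_sym, of x z y n] show False
        by (simp add: sphere_at_def children_def)
    qed
  qed (use Suc finite_children in auto)
  also have "\<dots> = (\<Sum>x\<in>sphere_at n. if n = 0 then q + 1 else q)"
    by (intro sum.cong) (auto simp: card_children sphere_at_def simp flip: height_eq_0_iff)
  finally show ?case
    using Suc by (auto simp: sphere_at_Suc finite_children)
qed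

lemma ball_eq_spheres: "graph_ball E v r = (\<Union>k\<le>r. sphere_at k)"
  by (auto simp: graph_ball_def sphere_at_def)

lemma finite_ball: "finite (graph_ball E v r)"
  using finite_card_sphere by (auto simp: ball_eq_spheres)

lemma sum_ball:
  fixes f :: "nat \<Rightarrow> 'b::comm_semiring_1"
  shows "(\<Sum>x\<in>graph_ball E v r. f (height x)) = (\<Sum>k\<le>r. of_nat (sphere_size k) * f k)"
proof -
  have "(\<Sum>x\<in>graph_ball E v r. f (height x)) = (\<Sum>k\<le>r. \<Sum>x\<in>sphere_at k. f (height x))"
    unfolding ball_eq_spheres
    by (rule sum.UNION_disjoint) (use finite_card_sphere in \<open>auto simp: sphere_at_def\<close>)
  also have "\<dots> = (\<Sum>k\<le>r. \<Sum>x\<in>sphere_at k. f k)"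
    by (intro sum.cong) (auto simp: sphere_at_def)
  finally show ?thesis using finite_card_sphere by simp
qed

lemma card_ball_pos: "0 < card (graph_ball E v r)"
proof -
  have "v \<in> graph_ball E v r" using height_eq_0_iff[of v] by (simp add: graph_ball_def)
  then show ?thesis using finite_ball by (auto simp: card_gt_0_iff)
qed

text \<open>The 4 is 2 times 2: one factor absorbs the extra child of the root through
  \<open>q + 1 \<le> 2 * q\<close>, the other bounds the geometric sum by its last term.\<close>

lemma card_ball_le:
  assumes "q \<ge> 2"
  shows "card (graph_ball E v r) \<le> 4 * q ^ r"
proof -
  have size: "sphere_size n \<le> 2 * q ^ n" for n
  proof (induction n)
    case (Suc n)
    then show ?case using assms by (cases n) auto
  qed simp
  have geom: "(\<Sum>k\<le>r. q ^ k) \<le> 2 * q ^ r"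
  proof (induction r)
    case (Suc r)
    have "2 * q ^ r \<le> q ^ Suc r" using mult_le_mono1[OF assms, of "q ^ r"] by simp
    with Suc show ?case unfolding sum.atMost_Suc by linarith
  qed simp
  have "card (graph_ball E v r) = (\<Sum>k\<le>r. sphere_size k)"
    using sum_ball[where f = "\<lambda>_. 1::nat"] by simp
  also have "\<dots> \<le> (\<Sum>k\<le>r. 2 * q ^ k)" using size by (intro sum_mono) auto
  also have "\<dots> \<le> 4 * q ^ r" using geom by (simp flip: sum_distrib_left)
  finally show ?thesis .
qed


section \<open>Spherical functions\<close>

text \<open>This is the radial eigenvalue equation solved for the next level: the root sees
  \<open>q + 1\<close> children, any other vertex sees one parent and \<open>q\<close>
  children.\<close>

fun spherical_profile :: "complex \<Rightarrow> nat \<Rightarrow> complex" where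
  "spherical_profile c 0 = 1"
| "spherical_profile c (Suc 0) = c / (of_nat q + 1)"
| "spherical_profile c (Suc (Suc n)) =
     (c * spherical_profile c (Suc n) - spherical_profile c n) / of_nat q"

text \<open>The equation at a vertex has one new unknown, the common value of \<open>w\<close> on
  the children, so the values are forced level by level. Together with
  \<open>eigenfunction_profile\<close> this justifies the \<open>THE\<close> in
  \<open>spherical_fun\<close>.\<close>

lemma eigenfunction_unique:
  assumes "q > 0" and rad: "radial E v w" and "w v = 1"
    and eig: "\<And>x. (\<Sum>y | E x y. w y) = c * w x"
  shows "w x = spherical_profile c (height x)"
proof -
  have children_sum: "(\<Sum>y\<in>children y. w y) = of_nat (card (children y)) * w x"
    if "height x = Suc (height y)" for x y
  proof -
    have "(\<Sum>y\<in>children y. w y) = (\<Sum>y\<in>children y. w x)"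
      using rad that by (intro sum.cong) (auto simp: children_def radial_def)
    then show ?thesis by simp
  qed
  have "w x = spherical_profile c n" if "height x = n" for n x
    using that
  proof (induction n arbitrary: x rule: less_induct)
    case (less n)
    show ?case
    proof (cases n)
      case 0
      then show ?thesis using less assms(3) by (simp add: height_eq_0_iff)
    next
      case (Suc m)
      \<comment> \<open>The value at \<open>x\<close> is read off from the equation at its parent,
        not at \<open>x\<close> itself.\<close>
      then obtain y where y: "E x y" "height y = m" using parent_exists less by blast
      have IH: "w y = spherical_profile c m" using less.IH y Suc by simp
      show ?thesis
      proof (cases m)
        case 0
        then have "y = v" using y height_eq_0_iff by simp
        then have "(of_nat q + 1) * w x = c"
          using eig[of v] children_sum[of x v] assms(3) Suc less.prems 0 y
          by (simp add: neighbours_root card_children)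
        moreover have "of_nat q + 1 \<noteq> (0::complex)"
          by (metis of_nat_Suc add.commute of_nat_eq_0_iff Zero_not_Suc)
        ultimately show ?thesis using Suc 0 by (simp add: field_simps)
      next
        case (Suc k)
        with y obtain u where u: "height u = k" "{u. E y u} = insert u (children y)"
          "u \<notin> children y"
          using neighbours_nonroot[of y k] by metis
        have "y \<noteq> v" using y Suc height_eq_0_iff[of y] by auto
        then have "w u + of_nat q * w x = c * w y"
          using eig[of y] u children_sum[of x y] less.prems \<open>n = Suc m\<close> y
          by (simp add: card_children finite_children)
        moreover have "w u = spherical_profile c k" using less.IH u Suc \<open>n = Suc m\<close> by simp
        ultimately show ?thesis
          using assms(1) IH Suc \<open>n = Suc m\<close> by (simp add: field_simps)
      qed
    qed
  qed
  then show ?thesis by simp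
qed

lemma eigenfunction_profile:
  assumes "q > 0"
  shows "(\<Sum>y | E x y. spherical_profile c (height y)) = c * spherical_profile c (height x)"
proof -
  have ch: "(\<Sum>y\<in>children x. spherical_profile c (height y))
      = of_nat (card (children x)) * spherical_profile c (Suc (height x))"
    by (simp add: children_def)
  show ?thesis
  proof (cases "height x")
    case 0
    then have x: "x = v" by (simp add: height_eq_0_iff)
    have "of_nat q + 1 \<noteq> (0::complex)"
      by (metis of_nat_Suc add.commute of_nat_eq_0_iff Zero_not_Suc)
    then show ?thesis using ch 0 unfolding x neighbours_root by (simp add: card_children add.commute)
  next
    case (Suc n)
    then obtain u where u: "height u = n" "{u. E x u} = insert u (children x)" "u \<notin> children x"
      using neighbours_nonroot[of x n] by metis
    have "x \<noteq> v" using Suc height_eq_0_iff[of x] by auto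
    then show ?thesis using ch Suc u assms by (simp add: finite_children card_children)
  qed
qed

lemma spherical_fun_eq:
  assumes "q > 0"
  shows "spherical_fun q E v z = (\<lambda>x. spherical_profile
    (2 * complex_of_real (sqrt (real q)) * cos (z * complex_of_real (ln (real q)))) (height x))"
    (is "_ = (\<lambda>x. spherical_profile ?c (height x))")
  unfolding spherical_fun_def
proof (rule the_equality)
  have "height v = 0" using height_eq_0_iff by blast
  then show "radial E v (\<lambda>x. spherical_profile ?c (height x)) \<and>
      spherical_profile ?c (height v) = 1 \<and>
      (\<forall>x. (\<Sum>y | E x y. spherical_profile ?c (height y)) = ?c * spherical_profile ?c (height x))"
    using eigenfunction_profile[OF assms] by (auto simp: radial_def)
next
  fix w assume "radial E v w \<and> w v = 1 \<and> (\<forall>x. (\<Sum>y | E x y. w y) = ?c * w x)"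
  then show "w = (\<lambda>x. spherical_profile ?c (height x))"
    using eigenfunction_unique[OF assms] by blast
qed

text \<open>\<open>T k\<close> is the sum over the sphere of radius \<open>k\<close>. The extra
  child of the root gives the third term the coefficient \<open>q + 1\<close> in place of
  \<open>q\<close>; in the sums over balls this defect cancels against \<open>T 0 = 1\<close>, so
  they obey one recursion from the start.\<close>

lemma sum_spherical_profile:
  assumes "q > 0"
  shows "(\<Sum>k\<le>r. of_nat (sphere_size k) * spherical_profile c k) = ball_poly q c r"
proof -
  have ne: "1 + of_nat q \<noteq> (0::complex)"
    by (metis of_nat_Suc of_nat_eq_0_iff Zero_not_Suc)
  define T where "T k = of_nat (sphere_size k) * spherical_profile c k" for k
  have T0: "T 0 = 1" and T1: "T (Suc 0) = c"
    using ne by (simp_all add: T_def field_simps)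
  have "T (Suc (Suc 0)) = of_nat q * (1 + of_nat q) * ((c * (c / (1 + of_nat q)) - 1) / of_nat q)"
    by (simp add: T_def algebra_simps)
  also have "\<dots> = (1 + of_nat q) * (c * (c / (1 + of_nat q)) - 1)"
    using assms by simp
  finally have "T (Suc (Suc 0)) = (1 + of_nat q) * (c * (c / (1 + of_nat q)) - 1)" .
  then have T2: "T (Suc (Suc 0)) = c * c - (of_nat q + 1)"
    using ne by (simp add: right_diff_distrib)
  have T3: "T (Suc (Suc (Suc n))) = c * T (Suc (Suc n)) - of_nat q * T (Suc n)" for n
  proof -
    have size: "sphere_size (Suc (Suc k)) = q * sphere_size (Suc k)" for k by simp
    have prof: "of_nat q * spherical_profile c (Suc (Suc k))
        = c * spherical_profile c (Suc k) - spherical_profile c k" for k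
      using assms by simp
    have "T (Suc (Suc (Suc n))) = of_nat (sphere_size (Suc (Suc n)))
        * (of_nat q * spherical_profile c (Suc (Suc (Suc n))))"
      unfolding T_def size[of "Suc n"] by simp
    also have "\<dots> = c * T (Suc (Suc n)) - of_nat (sphere_size (Suc (Suc n))) * spherical_profile c (Suc n)"
      unfolding prof T_def by (simp only: right_diff_distrib mult.left_commute)
    also have "of_nat (sphere_size (Suc (Suc n))) * spherical_profile c (Suc n) = of_nat q * T (Suc n)"
      unfolding T_def size by (simp only: of_nat_mult mult.assoc)
    finally show ?thesis .
  qed
  have rec: "(\<Sum>k\<le>Suc (Suc n). T k) = c * (\<Sum>k\<le>Suc n. T k) - of_nat q * (\<Sum>k\<le>n. T k)" for n
    by (induction n) (simp_all add: T0 T1 T2 T3 algebra_simps)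
  have "(\<Sum>k\<le>r. T k) = ball_poly q c r"
  proof (induction r rule: induct_nat_012)
    case (ge2 n)
    then show ?case using rec[of n] by simp
  qed (simp_all add: T0 T1)
  then show ?thesis by (simp add: T_def)
qed

lemma spherical_transform_ball:
  assumes "q > 0"
  shows "spherical_transform q E v (indicator (graph_ball E v r)) z =
    ball_poly q (2 * complex_of_real (sqrt (real q)) * cos (z * complex_of_real (ln (real q)))) r"
proof -
  have "{x. indicator (graph_ball E v r) x \<noteq> (0::complex)} = graph_ball E v r"
    by (auto simp: indicator_def)
  then show ?thesis
    unfolding spherical_transform_def spherical_fun_eq[OF assms]
    by (simp add: sum_ball[where f = "spherical_profile _"] sum_spherical_profile[OF assms]
        cong: sum.cong)
qed

end


section \<open>Growth of the normalised ball transform\<close>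

text \<open>For \<open>y = 2 cos \<theta>\<close> this is \<open>(sin ((n + 1) \<theta>) + h sin (n \<theta>)) / sin \<theta>\<close>.\<close>

fun ball_osc :: "real \<Rightarrow> real \<Rightarrow> nat \<Rightarrow> real" where
  "ball_osc h y 0 = 1"
| "ball_osc h y (Suc 0) = y + h"
| "ball_osc h y (Suc (Suc n)) = y * ball_osc h y (Suc n) - ball_osc h y n"

text \<open>Scaling the eigenvalue by \<open>sqrt q\<close> and splitting off
  \<open>sqrt q ^ r\<close> turns the coefficient \<open>q\<close> of the recursion into 1.\<close>

lemma ball_poly_eq_ball_osc:
  assumes "q > 0"
  shows "ball_poly q (complex_of_real (sqrt (real q) * y)) r
    = complex_of_real (sqrt (real q) ^ r * ball_osc (1 / sqrt (real q)) y r)"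
proof -
  have sq: "complex_of_real (sqrt (real q)) * complex_of_real (sqrt (real q)) = of_nat q"
    by (simp flip: of_real_mult)
  have ne: "complex_of_real (sqrt (real q)) \<noteq> 0" using assms by simp
  show ?thesis
  proof (induction "1 / sqrt (real q)" y r rule: ball_osc.induct)
    case (2 y)
    show ?case using ne by (simp add: distrib_left)
  next
    case (3 y n)
    have "complex_of_real (sqrt (real q)) * (complex_of_real (sqrt (real q)) * x) = of_nat q * x" for x
      using sq by (metis mult.assoc)
    with 3 sq show ?case by (simp add: algebra_simps)
  qed simp
qed

lemma continuous_ball_osc: "continuous_on A (\<lambda>y. ball_osc h y n)"
  \<comment> \<open>The \<open>0\<close> is a placeholder for \<open>y\<close>, which is bound in
    the goal; only the case distinction on \<open>n\<close> matters.\<close>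
  by (induction h "0::real" n rule: ball_osc.induct) (auto intro!: continuous_intros)

text \<open>With the middle value \<open>b\<close> fixed, the form
  \<open>a\<^sup>2 - y * a * b + b\<^sup>2\<close> is a quadratic in \<open>a\<close> that takes
  equal values at \<open>a\<close> and \<open>y * b - a\<close>, and the recursion makes exactly
  this exchange.\<close>

lemma ball_osc_invariant:
  "(ball_osc h y n)\<^sup>2 - y * ball_osc h y n * ball_osc h y (Suc n) + (ball_osc h y (Suc n))\<^sup>2
    = 1 + y * h + h\<^sup>2"
proof (induction n)
  case (Suc n)
  show ?case unfolding ball_osc.simps Suc[symmetric] by (simp add: power2_eq_square algebra_simps)
qed (simp add: power2_eq_square algebra_simps)

text \<open>The mixed term of the invariant form is at most \<open>M\<close> times the sum of the
  two squares. A single \<open>M\<close> serves the whole spectrum, so the bound can be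
  integrated.\<close>

lemma ball_osc_squares:
  assumes "\<bar>y\<bar> \<le> M"
  shows "1 + y * h + h\<^sup>2 \<le> (1 + M) * ((ball_osc h y n)\<^sup>2 + (ball_osc h y (Suc n))\<^sup>2)"
proof -
  define a b where "a = ball_osc h y n" and "b = ball_osc h y (Suc n)"
  have "\<bar>a * b\<bar> \<le> a\<^sup>2 + b\<^sup>2"
    using zero_le_power2[of "a - b"] zero_le_power2[of "a + b"] zero_le_power2[of a]
      zero_le_power2[of b]
    unfolding power2_diff power2_sum by linarith
  then have "\<bar>y\<bar> * \<bar>a * b\<bar> \<le> M * (a\<^sup>2 + b\<^sup>2)"
    using assms by (intro mult_mono) auto
  moreover have "- (y * (a * b)) \<le> \<bar>y\<bar> * \<bar>a * b\<bar>"
    by (metis abs_ge_minus_self abs_mult)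
  ultimately have "- (y * (a * b)) \<le> M * (a\<^sup>2 + b\<^sup>2)" by (rule order_trans[rotated])
  moreover have "1 + y * h + h\<^sup>2 = (a\<^sup>2 + b\<^sup>2) + - (y * (a * b))"
    using ball_osc_invariant[of h y n] by (simp add: a_def b_def mult.assoc)
  ultimately have "1 + y * h + h\<^sup>2 \<le> (a\<^sup>2 + b\<^sup>2) + M * (a\<^sup>2 + b\<^sup>2)"
    by (simp only: add_left_mono)
  then show ?thesis by (simp add: a_def b_def distrib_right)
qed

lemma ball_osc_minus: "ball_osc h (- y) n = (- 1) ^ n * ball_osc (- h) y n"
  by (induction "- h" y n rule: ball_osc.induct) (simp_all add: algebra_simps)

text \<open>The parameter \<open>k\<close> will be \<open>h\<close> on one axis and
  \<open>- h\<close> on the other. As \<open>exp \<theta>\<close> is at least 1, the worst case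
  \<open>k = - h\<close> still leaves \<open>(1 - h) * exp \<theta>\<close>.\<close>

lemma ball_osc_hyperbolic:
  assumes "\<theta> \<ge> 0" "\<bar>k\<bar> \<le> h" "h \<le> 1"
  shows "(1 - h) * exp (real n * \<theta>) \<le> ball_osc k (exp \<theta> + exp (- \<theta>)) n"
proof -
  let ?u = "ball_osc k (exp \<theta> + exp (- \<theta>))"
  \<comment> \<open>The numbers \<open>exp \<theta>\<close> and \<open>exp (- \<theta>)\<close> are
    the characteristic roots; subtracting \<open>exp (- \<theta>)\<close> times the previous term
    leaves a geometric sequence with ratio \<open>exp \<theta>\<close>.\<close>
  have rec: "?u (Suc n) = exp (- \<theta>) * ?u n + exp (real n * \<theta>) * (exp \<theta> + k)" for n
  proof (induction n)
    case (Suc n)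
    have "?u (Suc (Suc n)) = exp (- \<theta>) * ?u (Suc n) + exp \<theta> * (?u (Suc n) - exp (- \<theta>) * ?u n)"
      by (simp add: algebra_simps exp_minus)
    also have "?u (Suc n) - exp (- \<theta>) * ?u n = exp (real n * \<theta>) * (exp \<theta> + k)"
      using Suc by simp
    also have "exp \<theta> * (exp (real n * \<theta>) * (exp \<theta> + k)) = exp (real (Suc n) * \<theta>) * (exp \<theta> + k)"
      by (simp add: distrib_right exp_add)
    finally show ?case .
  qed simp
  show ?thesis
  proof (induction n)
    case 0
    then show ?case using assms by simp
  next
    case (Suc n)
    have "0 \<le> h" using assms(2) by linarith
    then have "(1 - h) * exp \<theta> \<le> exp \<theta> + k"
      using assms mult_left_mono[of 1 "exp \<theta>" h] unfolding left_diff_distrib by simp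
    then have "(1 - h) * exp \<theta> * exp (real n * \<theta>) \<le> (exp \<theta> + k) * exp (real n * \<theta>)"
      by (rule mult_right_mono) simp
    moreover have "0 \<le> ?u n"
      using assms(3) by (intro order_trans[OF _ Suc]) simp
    then have "0 \<le> exp (- \<theta>) * ?u n" by simp
    moreover have "(1 - h) * exp (real (Suc n) * \<theta>) = (1 - h) * exp \<theta> * exp (real n * \<theta>)"
      by (simp add: distrib_right exp_add)
    ultimately show ?case
      unfolding rec by (simp only: mult.commute[of "exp (real n * \<theta>)" "exp \<theta> + k"] add_increasing)
  qed
qed

lemma ball_osc_2: "ball_osc k 2 n = 1 + real n * (1 + k)"
  by (induction k "2::real" n rule: ball_osc.induct) (simp_all add: algebra_simps)

section \<open>The trace \<open>2 cos (z ln q)\<close> along the three branches of the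
  spectrum\<close>

text \<open>Taking \<open>Re\<close> makes the trace a real number everywhere; on
  \<open>spec_params q\<close> it discards nothing, by \<open>cos_spec\<close>.\<close>

definition spec_trace :: "nat \<Rightarrow> complex \<Rightarrow> real" where
  "spec_trace q z = Re (2 * cos (z * complex_of_real (ln (real q))))"

lemma spec_trace_real: "spec_trace q (complex_of_real a) = 2 * cos (a * ln (real q))"
  by (simp add: spec_trace_def Re_cos)

lemma spec_trace_axis:
  "spec_trace q (Complex 0 t) = exp (t * ln (real q)) + exp (- (t * ln (real q)))"
  by (simp add: spec_trace_def Re_cos)

lemma spec_trace_pi_axis:
  assumes "q \<ge> 2"
  shows "spec_trace q (Complex (pi / ln (real q)) t)
    = - (exp (t * ln (real q)) + exp (- (t * ln (real q))))"
  using assms by (simp add: spec_trace_def Re_cos)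

lemma spec_params_cases [consumes 1, case_names axis real pi_axis]:
  assumes "z \<in> spec_params q"
  obtains t where "z = Complex 0 t" "0 \<le> t" "t \<le> 1/2"
  | a where "z = complex_of_real a" "0 < a" "a < pi / ln (real q)"
  | t where "z = Complex (pi / ln (real q)) t" "0 \<le> t" "t \<le> 1/2"
  using assms unfolding spec_params_def by auto

text \<open>The imaginary part of the cosine is a product that vanishes on each branch: either the
  argument is real, or its real part is 0 or \<open>pi\<close>.\<close>

lemma cos_spec:
  assumes "q \<ge> 2" "z \<in> spec_params q"
  shows "2 * complex_of_real (sqrt (real q)) * cos (z * complex_of_real (ln (real q)))
    = complex_of_real (sqrt (real q) * spec_trace q z)"
proof -
  have "Im (cos (z * complex_of_real (ln (real q)))) = 0"
    using assms(2) by (cases rule: spec_params_cases) (use assms(1) in \<open>auto simp: Im_cos\<close>)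
  then show ?thesis
    by (simp add: spec_trace_def complex_eq_iff)
qed

lemma sqrt_eq_exp: "0 < x \<Longrightarrow> sqrt x = exp (1/2 * ln x)"
  using exp_ln[of "sqrt x"] by (simp add: ln_sqrt)

text \<open>For \<open>t \<le> 1/2\<close> the growing exponential is at most \<open>sqrt q\<close>
  and the decaying one at most 1; on the real branch 2 is below the same bound.\<close>

lemma spec_trace_bound:
  assumes "q \<ge> 2" "z \<in> spec_params q"
  shows "\<bar>spec_trace q z\<bar> \<le> sqrt (real q) + 1"
proof -
  have hyp: "exp (t * ln (real q)) + exp (- (t * ln (real q))) \<le> sqrt (real q) + 1"
    if "0 \<le> t" "t \<le> 1/2" for t
    using that assms(1)
    by (intro add_mono) (simp_all add: sqrt_eq_exp mult_right_mono)
  have pos: "\<bar>exp s + exp (- s)\<bar> = exp s + exp (- s)" for s :: real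
    by (simp add: add_nonneg_nonneg)
  show ?thesis
    using assms(2)
  proof (cases rule: spec_params_cases)
    case (real a)
    have "1 \<le> sqrt (real q)" using assms(1) by simp
    then show ?thesis
      using abs_cos_le_one[of "a * ln (real q)"] unfolding real spec_trace_real by linarith
  qed (use hyp pos in \<open>simp_all add: spec_trace_axis spec_trace_pi_axis[OF assms(1)] del: minus_add_distrib\<close>)
qed

text \<open>On \<open>spec_params q\<close> the expression vanishes exactly at the removed point \<open>Complex (pi / ln q) (1/2)\<close>.\<close>

lemma spec_trace_star_pos:
  assumes "q \<ge> 2" "z \<in> spec_params_star q"
  shows "0 < 1 + spec_trace q z * (1 / sqrt (real q)) + (1 / sqrt (real q))\<^sup>2"
proof -
  let ?h = "1 / sqrt (real q)"
  have h: "0 < ?h" "?h < 1" using assms(1) by auto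
  from assms(2) have "z \<in> spec_params q" and ne: "z \<noteq> Complex (pi / ln (real q)) (1/2)"
    by (auto simp: spec_params_star_def)
  from this(1) show ?thesis
  proof (cases rule: spec_params_cases)
    case (axis t)
    have "0 \<le> spec_trace q z * ?h" unfolding axis spec_trace_axis by (simp add: add_nonneg_nonneg)
    then show ?thesis by (simp add: add_pos_nonneg add.assoc)
  next
    case (real a)
    have "- 2 \<le> spec_trace q z" unfolding real spec_trace_real
      using cos_ge_minus_one[of "a * ln (real q)"] by linarith
    then have "- 2 * ?h \<le> spec_trace q z * ?h" using h by (intro mult_right_mono) auto
    moreover have "0 < (1 - ?h)\<^sup>2" using h by simp
    ultimately show ?thesis unfolding power2_diff by simp
  next
    case (pi_axis t)
    let ?\<theta> = "t * ln (real q)"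
    \<comment> \<open>The removed end point is used here; at \<open>t = 1/2\<close> the first factor
      of the product below would be zero.\<close>
    have "t < 1/2" using pi_axis ne by (cases "t = 1/2") auto
    then have "exp ?\<theta> < sqrt (real q)" using assms(1) by (simp add: sqrt_eq_exp)
    then have "?h * exp ?\<theta> < 1" using assms(1) by (simp add: field_simps)
    moreover have "?h * exp (- ?\<theta>) < 1"
    proof -
      have "exp (- ?\<theta>) \<le> 1" using pi_axis assms(1) by simp
      then have "?h * exp (- ?\<theta>) \<le> ?h * 1" using h by (intro mult_left_mono) auto
      then show ?thesis using h by linarith
    qed
    \<comment> \<open>The two exponentials are inverse to each other, so this product expands to the
      expression in the goal.\<close>
    ultimately have "0 < (1 - ?h * exp ?\<theta>) * (1 - ?h * exp (- ?\<theta>))" by simp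
    also have "\<dots> = 1 + spec_trace q z * ?h + ?h\<^sup>2"
      unfolding pi_axis spec_trace_pi_axis[OF assms(1)]
      by (simp add: algebra_simps power2_eq_square exp_minus)
    finally show ?thesis .
  qed
qed


section \<open>Lower bounds for the number variance\<close>

context
  fixes q :: nat and E :: "'v \<Rightarrow> 'v \<Rightarrow> bool" and v :: 'v and \<sigma> :: "complex measure"
  assumes q: "q \<ge> 2" and tree: "regular_tree q E" and fin: "finite_measure \<sigma>"
    and sets: "sets \<sigma> = sets (restrict_space borel (spec_params q))"
begin

abbreviation (input) osc :: "nat \<Rightarrow> complex \<Rightarrow> real" where
  "osc r z \<equiv> ball_osc (1 / sqrt (real q)) (spec_trace q z) r"

lemma space_sigma: "space \<sigma> = spec_params q"
  using sets_eq_imp_space_eq[OF sets] by (simp add: space_restrict_space)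

lemma star_sets: "spec_params_star q \<in> sets \<sigma>"
proof -
  let ?P = "{Complex 0 (1/2), Complex (pi / ln (real q)) (1/2)}"
  have "spec_params_star q = spec_params q \<inter> - ?P" by (auto simp: spec_params_star_def)
  moreover have "- ?P \<in> sets borel" by (intro borel_open open_Compl finite_imp_closed) simp
  ultimately show ?thesis unfolding sets sets_restrict_space by blast
qed

lemma NV_star_eq:
  "NV_star q E v \<sigma> r = real q ^ r * (LINT z:spec_params_star q|\<sigma>. (osc r z)\<^sup>2)"
proof -
  have "(cmod (spherical_transform q E v (indicator (graph_ball E v r)) z))\<^sup>2
      = real q ^ r * (osc r z)\<^sup>2" if "z \<in> spec_params_star q" for z
  proof -
    have z: "z \<in> spec_params q" using that by (simp add: spec_params_star_def)
    have "(sqrt (real q) ^ r)\<^sup>2 = real q ^ r"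
      by (simp flip: power_mult add: mult.commute[of r] power_mult)
    then show ?thesis
      using q by (simp add: spherical_transform_ball[OF tree] cos_spec[OF q z]
          ball_poly_eq_ball_osc norm_mult power_mult_distrib del: of_real_mult)
  qed
  then show ?thesis
    unfolding NV_star_def
    by (subst set_lebesgue_integral_cong[OF star_sets]) (auto simp: set_integral_mult_right)
qed

text \<open>The trace ranges over a compact interval, so \<open>f\<close> is bounded along it, and
  \<sigma> is finite.\<close>

lemma set_integrable_star:
  fixes f :: "real \<Rightarrow> real"
  assumes "continuous_on UNIV f"
  shows "set_integrable \<sigma> (spec_params_star q) (\<lambda>z. f (spec_trace q z))"
proof -
  let ?M = "sqrt (real q) + 1"
  have "bounded (f ` {- ?M .. ?M})"
    by (intro compact_imp_bounded compact_continuous_image continuous_on_subset[OF assms]) auto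
  then obtain B where B: "\<And>y. y \<in> {- ?M .. ?M} \<Longrightarrow> norm (f y) \<le> B"
    unfolding bounded_iff by blast
  have "continuous_on UNIV (\<lambda>z. f (spec_trace q z))"
    unfolding spec_trace_def
    by (intro continuous_on_compose2[OF assms] continuous_intros) auto
  then have "(\<lambda>z. f (spec_trace q z)) \<in> borel_measurable (restrict_space borel (spec_params q))"
    by (intro measurable_restrict_space1 borel_measurable_continuous_onI)
  then have meas: "(\<lambda>z. f (spec_trace q z)) \<in> borel_measurable \<sigma>"
    by (simp cong: measurable_cong_sets add: sets)
  have "integrable \<sigma> (\<lambda>z. f (spec_trace q z))"
  proof (rule finite_measure.integrable_const_bound[OF fin _ meas])
    show "AE z in \<sigma>. norm (f (spec_trace q z)) \<le> B"
    proof (rule AE_I2, rule B)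
      fix z assume "z \<in> space \<sigma>"
      then show "spec_trace q z \<in> {- ?M .. ?M}"
        using spec_trace_bound[OF q, of z] by (simp add: space_sigma abs_le_iff)
    qed
  qed
  then show ?thesis
    unfolding set_integrable_def by (intro integrable_mult_indicator star_sets)
qed

lemma set_integrable_osc: "set_integrable \<sigma> (spec_params_star q) (\<lambda>z. (osc r z)\<^sup>2)"
  by (rule set_integrable_star) (intro continuous_intros continuous_ball_osc)

text \<open>Both liminf bounds come from this restriction of the integral to a set \<open>A\<close>
  on which the transform is uniformly large.\<close>

lemma NV_star_lower:
  assumes "A \<in> sets \<sigma>" "A \<subseteq> spec_params_star q" "\<And>z. z \<in> A \<Longrightarrow> m \<le> (osc r z)\<^sup>2"
  shows "real q ^ r * (m * measure \<sigma> A) \<le> NV_star q E v \<sigma> r"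
proof -
  have "m * measure \<sigma> A = (LINT z|\<sigma>. indicator A z * m)"
    using assms(1) by (simp add: mult.commute)
  also have "\<dots> \<le> (LINT z:spec_params_star q|\<sigma>. (osc r z)\<^sup>2)"
    unfolding set_lebesgue_integral_def
  proof (rule integral_mono)
    show "integrable \<sigma> (\<lambda>z. indicator A z * m)"
      using assms(1) finite_measure.emeasure_finite[OF fin]
      by (intro integrable_mult_left integrable_real_indicator) (auto simp: less_top)
    show "integrable \<sigma> (\<lambda>z. indicator (spec_params_star q) z *\<^sub>R (osc r z)\<^sup>2)"
      using set_integrable_osc by (simp add: set_integrable_def)
  qed (use assms(2,3) in \<open>auto simp: indicator_def\<close>)
  finally show ?thesis unfolding NV_star_eq by (intro mult_left_mono) auto
qed

lemma NV_star_nonneg: "0 \<le> NV_star q E v \<sigma> r"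
  unfolding NV_star_def set_lebesgue_integral_def by (intro integral_nonneg_AE) simp

lemma card_ball_bound:
  "0 < real (card (graph_ball E v r))" "real (card (graph_ball E v r)) \<le> 4 * real q ^ r"
  using card_ball_pos[OF tree, of v r] card_ball_le[OF tree q, of v r]
    of_nat_le_iff[of "card (graph_ball E v r)" "4 * q ^ r", where ?'a = real]
  by simp_all

section \<open>The limsup bound from two consecutive radii\<close>

lemma NV_star_limsup:
  assumes "measure \<sigma> (spec_params_star q) > 0"
  shows "limsup (\<lambda>r. ereal (NV_star q E v \<sigma> r / real (card (graph_ball E v r)))) > 0"
proof -
  let ?S = "spec_params_star q" and ?h = "1 / sqrt (real q)" and ?M = "sqrt (real q) + 1"
  let ?Q = "\<lambda>z. 1 + spec_trace q z * ?h + ?h\<^sup>2"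
  let ?a = "\<lambda>r. NV_star q E v \<sigma> r / real (card (graph_ball E v r))"
  define I where "I r = (LINT z:?S|\<sigma>. (osc r z)\<^sup>2)" for r
  define \<kappa> where "\<kappa> = (LINT z:?S|\<sigma>. ?Q z)"
  have intQ: "set_integrable \<sigma> ?S ?Q"
    by (rule set_integrable_star) (intro continuous_intros)
  have nonneg: "0 \<le> indicator ?S z *\<^sub>R ?Q z" for z
    using spec_trace_star_pos[OF q, of z] by (auto simp: indicator_def)
  \<comment> \<open>The integrand is strictly positive on \<open>?S\<close>, so a vanishing integral
    would make \<open>?S\<close> a null set, against the assumed mass.\<close>
  have "\<kappa> \<noteq> 0"
  proof
    assume "\<kappa> = 0"
    then have "AE z in \<sigma>. indicator ?S z *\<^sub>R ?Q z = 0"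
      using integral_nonneg_eq_0_iff_AE[of \<sigma> "\<lambda>z. indicator ?S z *\<^sub>R ?Q z"] intQ nonneg
      unfolding \<kappa>_def set_lebesgue_integral_def set_integrable_def by auto
    then have "AE z in \<sigma>. z \<notin> ?S"
      by eventually_elim (use spec_trace_star_pos[OF q] in \<open>fastforce simp: indicator_def\<close>)
    then have "emeasure \<sigma> ?S = 0"
      using AE_iff_measurable[OF star_sets, of "\<lambda>z. z \<notin> ?S"] sets.sets_into_space[OF star_sets]
      by auto
    then show False using assms by (simp add: measure_def)
  qed
  moreover have "0 \<le> \<kappa>"
    unfolding \<kappa>_def set_lebesgue_integral_def by (intro integral_nonneg_AE AE_I2 nonneg)
  ultimately have "0 < \<kappa>" by simp
  have M: "0 < 1 + ?M" by (simp add: add_pos_nonneg)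
  have two: "\<kappa> \<le> (1 + ?M) * (I r + I (Suc r))" for r
  proof -
    have "\<kappa> \<le> (LINT z:?S|\<sigma>. (1 + ?M) * ((osc r z)\<^sup>2 + (osc (Suc r) z)\<^sup>2))"
      unfolding \<kappa>_def
    proof (rule set_integral_mono[OF intQ])
      show "set_integrable \<sigma> ?S (\<lambda>z. (1 + ?M) * ((osc r z)\<^sup>2 + (osc (Suc r) z)\<^sup>2))"
        by (intro set_integrable_mult_right set_integral_add set_integrable_osc)
      fix z assume "z \<in> ?S"
      then show "?Q z \<le> (1 + ?M) * ((osc r z)\<^sup>2 + (osc (Suc r) z)\<^sup>2)"
        by (intro ball_osc_squares spec_trace_bound[OF q]) (simp add: spec_params_star_def)
    qed
    then show ?thesis
      unfolding I_def
      by (simp add: set_integral_mult_right set_integral_add set_integrable_osc)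
  qed
  \<comment> \<open>One of \<open>I r\<close> and \<open>I (Suc r)\<close> is at least
    \<open>\<kappa> / (2 * (1 + ?M))\<close>; the last 4 is the constant in the bound on the ball
    size.\<close>
  define c where "c = \<kappa> / (2 * (1 + ?M)) / 4"
  have "0 < c" using \<open>0 < \<kappa>\<close> M by (simp add: c_def)
  have le: "I r / 4 \<le> ?a r" for r
  proof -
    have "0 \<le> I r" unfolding I_def set_lebesgue_integral_def by (intro integral_nonneg_AE) simp
    then have "real q ^ r * I r / (4 * real q ^ r) \<le> ?a r"
      unfolding NV_star_eq I_def[symmetric]
      using card_ball_bound q by (intro divide_left_mono) auto
    then show ?thesis using q by simp
  qed
  have "ereal c \<le> limsup (\<lambda>r. ereal (?a r))"
  proof (rule ccontr)
    assume "\<not> ?thesis"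
    then have "eventually (\<lambda>r. ereal (?a r) < ereal c) sequentially"
      by (intro Limsup_lessD) simp
    then obtain N where N: "\<And>r. r \<ge> N \<Longrightarrow> ?a r < c"
      by (auto simp: eventually_sequentially)
    \<comment> \<open>Two consecutive quotients below \<open>c\<close> already contradict
      \<open>two\<close>, since \<open>8 * c\<close> equals
      \<open>\<kappa> / (1 + ?M)\<close>.\<close>
    have "I N + I (Suc N) < 8 * c"
      using N[of N] N[of "Suc N"] le[of N] le[of "Suc N"] by linarith
    then have "(1 + ?M) * (I N + I (Suc N)) < (1 + ?M) * (8 * c)"
      using M by (intro mult_strict_left_mono)
    also have "\<dots> = \<kappa>"
    proof -
      have "x * (8 * (\<kappa> / (2 * x) / 4)) = \<kappa>" if "0 < x" for x using that by simp
      from this[OF M] show ?thesis by (simp only: c_def)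
    qed
    finally show False using two[of N] by simp
  qed
  then show ?thesis using \<open>0 < c\<close> by (simp add: less_le_trans[of 0 "ereal c"])
qed

section \<open>The liminf bounds from mass at trace 2 and -2 and on the two axes\<close>

text \<open>Index 0 is left out because a quotient with \<open>(real r)\<^sup>2\<close> in its
  denominator is 0 there by the convention on division.\<close>

lemma liminf_pos:
  assumes "0 < c" "\<And>r. r > 0 \<Longrightarrow> c \<le> a r"
  shows "0 < liminf (\<lambda>r. ereal (a r))"
proof -
  have "ereal c \<le> liminf (\<lambda>r. ereal (a r))"
    by (intro Liminf_bounded eventually_mono[OF eventually_gt_at_top[of 0]]) (use assms in auto)
  then show ?thesis using assms(1) by (simp add: less_le_trans[of 0 "ereal c"])
qed

text \<open>On the branch over \<open>pi / ln q\<close> the trace changes sign, which amounts to replacing \<open>h\<close> by \<open>- h\<close>.\<close>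

lemma osc_axes_lower:
  assumes "z = Complex 0 t \<or> z = Complex (pi / ln (real q)) t"
    and "\<And>k. \<bar>k\<bar> \<le> 1 / sqrt (real q) \<Longrightarrow>
      b \<le> ball_osc k (exp (t * ln (real q)) + exp (- (t * ln (real q)))) r"
    and "0 \<le> b"
  shows "b\<^sup>2 \<le> (osc r z)\<^sup>2"
proof -
  have "b \<le> \<bar>osc r z\<bar>"
    using assms(1)
  proof
    assume "z = Complex 0 t"
    then show ?thesis
      using assms(2)[of "1 / sqrt (real q)"] by (simp add: spec_trace_axis)
  next
    assume "z = Complex (pi / ln (real q)) t"
    then show ?thesis
      using assms(2)[of "- (1 / sqrt (real q))"]
      by (simp add: spec_trace_pi_axis[OF q] ball_osc_minus abs_mult power_abs
          del: minus_add_distrib)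
  qed
  then show ?thesis using assms(3) power_mono[of b "\<bar>osc r z\<bar>" 2] by simp
qed

lemma axes_subset_star:
  assumes "T \<subseteq> {0..<1/2}"
  shows "Complex 0 ` T \<subseteq> spec_params_star q" "Complex (pi / ln (real q)) ` T \<subseteq> spec_params_star q"
  using assms unfolding spec_params_star_def spec_params_def by force+

text \<open>At both points the trace is 2 up to sign, a double characteristic root, so the transform
  grows linearly by \<open>ball_osc_2\<close> and its square contributes the factor
  \<open>(real r)\<^sup>2\<close>.\<close>

lemma NV_star_liminf_square:
  assumes "measure \<sigma> {0, complex_of_real (pi / ln (real q))} > 0"
  shows "liminf (\<lambda>r. ereal (NV_star q E v \<sigma> r
           / ((real r)\<^sup>2 * real (card (graph_ball E v r))))) > 0"
proof -
  let ?A = "{0, complex_of_real (pi / ln (real q))}" and ?h = "1 / sqrt (real q)"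
  define c where "c = (1 - ?h)\<^sup>2 * measure \<sigma> ?A"
  have h: "0 < ?h" "?h < 1" using q by auto
  \<comment> \<open>Since \<open>measure\<close> is 0 on sets outside the sigma-algebra, positive
    measure already gives measurability.\<close>
  have A: "?A \<in> sets \<sigma>" using assms measure_notin_sets by fastforce
  have pts: "?A = Complex 0 ` {0} \<union> Complex (pi / ln (real q)) ` {0}"
    by (auto simp: complex_eq_iff)
  have sub: "?A \<subseteq> spec_params_star q"
    unfolding pts using axes_subset_star[of "{0}"] by simp
  have low: "((1 - ?h) * real r)\<^sup>2 \<le> (osc r z)\<^sup>2" if "z \<in> ?A" for r z
  proof (rule osc_axes_lower)
    show "z = Complex 0 0 \<or> z = Complex (pi / ln (real q)) 0" using that unfolding pts by auto
    fix k assume k: "\<bar>k\<bar> \<le> ?h"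
    have "(1 - ?h) * real r \<le> (1 + k) * real r" using k by (intro mult_right_mono) auto
    then show "(1 - ?h) * real r \<le> ball_osc k (exp (0 * ln (real q)) + exp (- (0 * ln (real q)))) r"
      by (simp add: ball_osc_2 mult.commute)
  qed (use h in simp)
  show ?thesis
  proof (rule liminf_pos)
    show "0 < c / 4" using assms h by (simp add: c_def)
    fix r :: nat assume r: "r > 0"
    have "c / 4 = real q ^ r * (((1 - ?h) * real r)\<^sup>2 * measure \<sigma> ?A) / ((real r)\<^sup>2 * (4 * real q ^ r))"
      using r q by (simp add: c_def power_mult_distrib)
    also have "\<dots> \<le> NV_star q E v \<sigma> r / ((real r)\<^sup>2 * real (card (graph_ball E v r)))"
      using r q card_ball_bound[of r] NV_star_nonneg[of r] NV_star_lower[OF A sub low]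
      by (intro frac_le mult_left_mono) auto
    finally show "c / 4 \<le> \<dots>" .
  qed
qed

text \<open>For \<open>t \<ge> \<delta>/2\<close> the squared transform is at least a constant times
  \<open>q\<close> to the power \<open>r * \<delta>\<close>; with the prefactor
  \<open>real q ^ r\<close> this matches the power \<open>1 + \<delta>\<close> of the ball
  size.\<close>

lemma NV_star_liminf_powr:
  assumes "0 < \<delta>"
    and "measure \<sigma> (Complex 0 ` {\<delta>/2..<1/2}) > 0
      \<or> measure \<sigma> (Complex (pi / ln (real q)) ` {\<delta>/2..<1/2}) > 0"
  shows "liminf (\<lambda>r. ereal (NV_star q E v \<sigma> r / real (card (graph_ball E v r)) powr (1 + \<delta>))) > 0"
proof -
  let ?h = "1 / sqrt (real q)"
  obtain A where pos: "measure \<sigma> A > 0"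
    and A_cases: "A = Complex 0 ` {\<delta>/2..<1/2} \<or> A = Complex (pi / ln (real q)) ` {\<delta>/2..<1/2}"
    using assms(2) by blast
  define c where "c = (1 - ?h)\<^sup>2 * measure \<sigma> A"
  have h: "0 < ?h" "?h < 1" using q by auto
  have A: "A \<in> sets \<sigma>" using pos measure_notin_sets by fastforce
  have "{\<delta>/2..<1/2} \<subseteq> {0..<1/2}" using assms(1) by simp
  from axes_subset_star[OF this] have sub: "A \<subseteq> spec_params_star q" using A_cases by blast
  have low: "((1 - ?h) * exp (real r * (\<delta>/2 * ln (real q))))\<^sup>2 \<le> (osc r z)\<^sup>2" if "z \<in> A" for r z
  proof -
    obtain t where t: "z = Complex 0 t \<or> z = Complex (pi / ln (real q)) t" "t \<in> {\<delta>/2..<1/2}"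
      using \<open>z \<in> A\<close> A_cases by blast
    show ?thesis
    proof (rule osc_axes_lower[OF t(1)])
      fix k assume k: "\<bar>k\<bar> \<le> ?h"
      have "real r * (\<delta>/2 * ln (real q)) \<le> real r * (t * ln (real q))"
        using t(2) q by (intro mult_left_mono mult_right_mono) auto
      then have "(1 - ?h) * exp (real r * (\<delta>/2 * ln (real q))) \<le> (1 - ?h) * exp (real r * (t * ln (real q)))"
        using h by (intro mult_left_mono) auto
      also have "\<dots> \<le> ball_osc k (exp (t * ln (real q)) + exp (- (t * ln (real q)))) r"
        using t(2) assms(1) h q k by (intro ball_osc_hyperbolic) auto
      finally show "(1 - ?h) * exp (real r * (\<delta>/2 * ln (real q)))
        \<le> ball_osc k (exp (t * ln (real q)) + exp (- (t * ln (real q)))) r" .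
    qed (use h in simp)
  qed
  show ?thesis
  proof (rule liminf_pos)
    \<comment> \<open>The 4 from the bound on the ball size is raised to the same power as the ball
      size.\<close>
    show "0 < c / 4 powr (1 + \<delta>)" using pos h by (simp add: c_def)
    fix r :: nat
    have "(exp (real r * (\<delta>/2 * ln (real q))))\<^sup>2 = (real q ^ r) powr \<delta>"
      using q by (simp add: powr_def ln_realpow power2_eq_square field_simps flip: exp_add)
    then have "c / 4 powr (1 + \<delta>)
        = real q ^ r * (((1 - ?h) * exp (real r * (\<delta>/2 * ln (real q))))\<^sup>2 * measure \<sigma> A)
          / (4 * real q ^ r) powr (1 + \<delta>)"
      using q by (simp add: c_def power_mult_distrib powr_mult powr_add)
    also have "\<dots> \<le> NV_star q E v \<sigma> r / real (card (graph_ball E v r)) powr (1 + \<delta>)"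
      using q card_ball_bound[of r] NV_star_nonneg[of r] NV_star_lower[OF A sub low] assms(1)
      by (intro frac_le powr_mono2) auto
    finally show "c / 4 powr (1 + \<delta>) \<le> \<dots>" .
  qed
qed

end

theorem theorem1p3:
  fixes q :: nat and E :: "'v \<Rightarrow> 'v \<Rightarrow> bool" and v :: 'v
    and \<mu> :: "('v \<Rightarrow> real) measure" and \<sigma> :: "complex measure"
  assumes "q \<ge> 2" and "regular_tree q E"
    and "point_process \<mu>" and "invariant_process E \<mu>" and "locally_square_integrable \<mu>"
    and "diffraction_measure q E v \<mu> \<sigma>"
  shows "(measure \<sigma> (spec_params_star q) > 0 \<longrightarrow>
            limsup (\<lambda>r. ereal (NV_star q E v \<sigma> r / real (card (graph_ball E v r)))) > 0)
       \<and> (measure \<sigma> {0, complex_of_real (pi / ln (real q))} > 0 \<longrightarrow>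
            liminf (\<lambda>r. ereal (NV_star q E v \<sigma> r / ((real r)\<^sup>2 * real (card (graph_ball E v r))))) > 0)
       \<and> (\<forall>\<delta>::real. 0 < \<delta> \<and> \<delta> < 1 \<and>
            (measure \<sigma> (Complex 0 ` {\<delta>/2..<1/2}) > 0
              \<or> measure \<sigma> (Complex (pi / ln (real q)) ` {\<delta>/2..<1/2}) > 0) \<longrightarrow>
            liminf (\<lambda>r. ereal (NV_star q E v \<sigma> r / real (card (graph_ball E v r)) powr (1 + \<delta>))) > 0)"
proof -
  have "finite_measure \<sigma>" "sets \<sigma> = sets (restrict_space borel (spec_params q))"
    using assms(6) by (simp_all add: diffraction_measure_def)
  from NV_star_limsup[OF assms(1,2) this] NV_star_liminf_square[OF assms(1,2) this]
    NV_star_liminf_powr[OF assms(1,2) this]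
  show ?thesis by blast
qed

end
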